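(* Let $n>k\ge 1$ be integers, let $\boldsymbol{X}\in\mathbb{R}^{n\times k}$ have rank $k$, let $\boldsymbol{K}\in\mathbb{R}^{k\times k}$ be symmetric positive semidefinite, and let $\boldsymbol{W}\in\mathbb{R}^{n\times n}$ be a spatial weights matrix. Let $\rho\in\mathbb{R}$ with $\rho\neq 0$, and let $\boldsymbol{\Omega}$ be one of the following two matrices: $$\boldsymbol{\Omega}=(\boldsymbol{I}_n-\rho\boldsymbol{W})^{-1}(\boldsymbol{I}_n-\rho\boldsymbol{W}^\top)^{-1}\ \text{ (where $\boldsymbol{I}_n-\rho\boldsymbol{W}$ is nonsingular)},$$ $$\boldsymbol{\Omega}=(\boldsymbol{I}_n+\rho\boldsymbol{W})(\boldsymbol{I}_n+\rho\boldsymbol{W}^\top)\ \text{ (where $\boldsymbol{I}_n+\rho\boldsymbol{W}$ is nonsingular)}.$$ Put $$\widetilde{\boldsymbol{W}}=\begin{pmatrix}\boldsymbol{W}&\boldsymbol{0}\\ \boldsymbol{0}&\boldsymbol{0}\end{pmatrix}\in\mathbb{R}^{(n+k)\times(n+k)},\qquad \boldsymbol{Z}=\begin{pmatrix}\boldsymbol{X}\\ \boldsymbol{K}\end{pmatrix}\in\mathbb{R}^{(n+k)\times k},\qquad \boldsymbol{P}_Z=\boldsymbol{Z}(\boldsymbol{Z}^\top\boldsymbol{Z})^{-1}\boldsymbol{Z}^\top .$$ If $\widetilde{\boldsymbol{W}}\boldsymbol{P}_Z=\boldsymbol{P}_Z\widetilde{\boldsymbol{W}}$, then $\hat{\boldsymbol{\beta}}_{GR}(\boldsymbol{\Omega},\boldsymbol{K})=\hat{\boldsymbol{\beta}}_{GR}(\boldsymbol{I}_n,\boldsymbol{K})$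 for all $\boldsymbol{y}\in\mathbb{R}^n$.
   Context: $\boldsymbol{I}_m$ is the $m\times m$ identity matrix. A spatial weights matrix is a matrix $\boldsymbol{W}=(w_{ij})\in\mathbb{R}^{n\times n}$ with $w_{ij}\ge 0$ (not necessarily symmetric). For a symmetric positive definite $\boldsymbol{\Phi}\in\mathbb{R}^{n\times n}$ and $\boldsymbol{y}\in\mathbb{R}^n$, the general ridge estimator is $$\hat{\boldsymbol{\beta}}_{GR}(\boldsymbol{\Phi},\boldsymbol{K})=(\boldsymbol{X}^\top\boldsymbol{\Phi}^{-1}\boldsymbol{X}+\boldsymbol{K})^{-1}\boldsymbol{X}^\top\boldsymbol{\Phi}^{-1}\boldsymbol{y}\in\mathbb{R}^k .$$ $\boldsymbol{Z}$ has full column rank, and $\boldsymbol{P}_Z$ is the orthogonal projector onto its column space. The first form of $\boldsymbol{\Omega}$ corresponds to a first-order spatial autoregressive (SAR(1)) disturbance process, the second to a first-order spatial moving average (SMA(1)) process. *)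

theory Defs
  imports "HOL-Analysis.Analysis"
begin

definition symmetric_psd :: "real^'m^'m \<Rightarrow> bool" where
  "symmetric_psd A \<longleftrightarrow> transpose A = A \<and> (\<forall>x. 0 \<le> x \<bullet> (A *v x))"

definition spatial_weights_matrix :: "real^'n^'n \<Rightarrow> bool" where
  "spatial_weights_matrix W \<longleftrightarrow> (\<forall>i j. 0 \<le> W $ i $ j)"

text \<open>
  The estimator is meant for symmetric positive definite \<open>\<Phi>\<close>, \<open>X\<close> of full column rank and
  symmetric positive semidefinite \<open>K\<close>; both inverses then exist. On a singular matrix
  \<^const>\<open>matrix_inv\<close> is unspecified.
\<close>
definition ridge_estimator ::
  "real^'k^'n \<Rightarrow> real^'n^'n \<Rightarrow> real^'k^'k \<Rightarrow> real^'n \<Rightarrow> real^'k" where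
  "ridge_estimator X \<Phi> K y =
     matrix_inv (transpose X ** matrix_inv \<Phi> ** X + K) *v
       (transpose X *v (matrix_inv \<Phi> *v y))"

text \<open>
  Block matrices are indexed by the sum type \<open>'n + 'k\<close>, of cardinality \<open>n + k\<close>: \<^const>\<open>Inl\<close>
  selects the first \<open>n\<close> rows or columns and \<^const>\<open>Inr\<close> the last \<open>k\<close>.
\<close>
definition block_matrix ::
  "real^'c^'a \<Rightarrow> real^'d^'a \<Rightarrow> real^'c^'b \<Rightarrow> real^'d^'b \<Rightarrow> real^('c + 'd)^('a + 'b)" where
  "block_matrix A B C D = (\<chi> i j. case i of
       Inl p \<Rightarrow> (case j of Inl q \<Rightarrow> A $ p $ q | Inr q \<Rightarrow> B $ p $ q)
     | Inr p \<Rightarrow> (case j of Inl q \<Rightarrow> C $ p $ q | Inr q \<Rightarrow> D $ p $ q))"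

definition stack_matrix :: "real^'c^'a \<Rightarrow> real^'c^'b \<Rightarrow> real^'c^('a + 'b)" where
  "stack_matrix A B = (\<chi> i. case i of Inl p \<Rightarrow> A $ p | Inr p \<Rightarrow> B $ p)"

text \<open>For \<open>Z\<close> of full column rank, the orthogonal projector onto the column space of \<open>Z\<close>.\<close>
definition column_projector :: "real^'k^'m \<Rightarrow> real^'m^'m" where
  "column_projector Z = Z ** matrix_inv (transpose Z ** Z) ** transpose Z"

end

theory Submission
  imports Defs
begin

text \<open>
  Both estimators solve a penalised least squares problem, and \<open>\<Omega>\<close> leaves the solution unchanged
  as soon as \<open>\<Omega>\<inverse>\<close>, extended by the identity on the last \<open>k\<close> coordinates, maps the column space of
  \<open>Z = (X; K)\<close> onto itself, that is, as soon as \<open>\<Omega>\<inverse> X = X G\<close> and \<open>K G = K\<close> for one invertible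
  \<open>G\<close>. Indeed, by symmetry of \<open>\<Omega>\<close> and \<open>K\<close>, the normal equations for \<open>\<Omega>\<close> are then the
  ordinary ones multiplied from the left by \<open>G\<^sup>T\<close>:
  \<open>X\<^sup>T \<Omega>\<inverse> X + K = G\<^sup>T (X\<^sup>T X + K)\<close> and \<open>X\<^sup>T \<Omega>\<inverse> = G\<^sup>T X\<^sup>T\<close>. This is
  \<open>ridge_estimator_eq_if_stack_invariant\<close>.

  The matrices with this invariance (\<open>stack_invariant\<close> below) are closed under products and
  inverses. So it suffices to find the factors \<open>I + c W\<close> and \<open>I + c W\<^sup>T\<close> of \<open>\<Omega>\<close> or
  \<open>\<Omega>\<inverse>\<close> among them; both disturbance processes are then covered. If the block
  matrix of \<open>W\<close> commutes with the projector \<open>P\<close> onto the column space of \<open>Z\<close>, then it maps that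
  space into itself; comparing blocks gives \<open>W X = X M\<close> and \<open>K M = 0\<close>, so \<open>G = I + c M\<close>
  works for \<open>I + c W\<close>. Since \<open>P\<close> is symmetric, the transposed block matrix commutes with it as
  well, and the same applies to \<open>W\<^sup>T\<close>.
\<close>

section \<open>Matrix inverses and Gram matrices\<close>

lemma matrix_add_rdistrib:
  fixes A B :: "real^'b^'a" and C :: "real^'c^'b"
  shows "(A + B) ** C = A ** C + B ** C"
  by (simp add: matrix_matrix_mult_def vec_eq_iff sum.distrib distrib_right)

lemma transpose_add:
  fixes A B :: "real^'b^'a"
  shows "transpose (A + B) = transpose A + transpose B"
  by (simp add: transpose_def vec_eq_iff)

lemma transpose_zero: "transpose (0 :: real^'b^'a) = 0"
  by (simp add: transpose_def vec_eq_iff)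

lemma matrix_inv_inverse:
  fixes A :: "real^'a^'a"
  assumes "invertible A"
  shows matrix_inv_left: "matrix_inv A ** A = mat 1"
    and matrix_inv_right: "A ** matrix_inv A = mat 1"
proof -
  from assms have "A ** matrix_inv A = mat 1 \<and> matrix_inv A ** A = mat 1"
    unfolding matrix_inv_def invertible_def by (rule someI_ex)
  then show "matrix_inv A ** A = mat 1" "A ** matrix_inv A = mat 1"
    by simp_all
qed

lemma invertible_matrix_inv:
  fixes A :: "real^'a^'a"
  assumes "invertible A"
  shows "invertible (matrix_inv A)"
  using matrix_inv_inverse[OF assms] unfolding invertible_def by blast

lemma matrix_inv_eqI:
  fixes A B :: "real^'a^'a"
  assumes "A ** B = mat 1"
  shows "matrix_inv A = B"
proof -
  have "invertible A"
    using assms invertible_right_inverse by blast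
  then have "matrix_inv A ** (A ** B) = B"
    by (simp add: matrix_mul_assoc matrix_inv_left)
  with assms show ?thesis
    by simp
qed

lemma matrix_inv_mat_1: "matrix_inv (mat 1 :: real^'a^'a) = mat 1"
  by (rule matrix_inv_eqI) simp

lemma matrix_inv_product:
  fixes A B :: "real^'a^'a"
  assumes "invertible A" "invertible B"
  shows "matrix_inv (A ** B) = matrix_inv B ** matrix_inv A"
proof (rule matrix_inv_eqI)
  have "A ** B ** (matrix_inv B ** matrix_inv A) = A ** (B ** matrix_inv B) ** matrix_inv A"
    by (simp add: matrix_mul_assoc)
  then show "A ** B ** (matrix_inv B ** matrix_inv A) = mat 1"
    using assms by (simp add: matrix_inv_right)
qed

lemma matrix_inv_matrix_inv:
  fixes A :: "real^'a^'a"
  assumes "invertible A"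
  shows "matrix_inv (matrix_inv A) = A"
  by (rule matrix_inv_eqI) (rule matrix_inv_left[OF assms])

lemma transpose_matrix_inv:
  fixes A :: "real^'a^'a"
  assumes "invertible A"
  shows "transpose (matrix_inv A) = matrix_inv (transpose A)"
  by (rule matrix_inv_eqI[symmetric])
    (simp add: matrix_transpose_mul[symmetric] matrix_inv_left[OF assms])

lemma invertible_if_trivial_kernel:
  fixes A :: "real^'a^'a"
  assumes "\<And>x. A *v x = 0 \<Longrightarrow> x = 0"
  shows "invertible A"
  using assms matrix_left_invertible_ker[of A] invertible_left_inverse[of A] by blast

text \<open>
  The quadratic form of this matrix is \<open>|X v|\<^sup>2 + v \<bullet> K v\<close>, which vanishes only at \<open>v = 0\<close>. The
  case \<open>K = 0\<close> gives the Gram matrix that the projector inverts.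
\<close>
lemma invertible_gram_plus_psd:
  fixes X :: "real^'k^'m" and K :: "real^'k^'k"
  assumes "\<And>v. X *v v = 0 \<Longrightarrow> v = 0" and "\<And>v. 0 \<le> v \<bullet> (K *v v)"
  shows "invertible (transpose X ** X + K)"
proof (rule invertible_if_trivial_kernel)
  fix v
  assume "(transpose X ** X + K) *v v = 0"
  then have "0 = v \<bullet> (transpose X *v (X *v v)) + v \<bullet> (K *v v)"
    by (metis inner_add_right inner_zero_right matrix_vector_mul_assoc
        matrix_vector_mult_add_rdistrib)
  also have "v \<bullet> (transpose X *v (X *v v)) = (X *v v) \<bullet> (X *v v)"
    by (metis dot_lmul_matrix inner_commute transpose_matrix_vector)
  finally have "(X *v v) \<bullet> (X *v v) \<le> 0"
    using assms(2)[of v] by linarith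
  then have "X *v v = 0"
    by (metis inner_eq_zero_iff inner_ge_zero order_antisym)
  then show "v = 0"
    by (rule assms(1))
qed

section \<open>The projector and block matrices\<close>

lemma column_projector_mult:
  fixes Z :: "real^'k^'m"
  assumes "invertible (transpose Z ** Z)"
  shows "column_projector Z ** Z = Z"
  unfolding column_projector_def
  by (metis assms matrix_inv_left matrix_mul_assoc matrix_mul_rid)

lemma transpose_column_projector:
  fixes Z :: "real^'k^'m"
  assumes "invertible (transpose Z ** Z)"
  shows "transpose (column_projector Z) = column_projector Z"
  unfolding column_projector_def
  by (simp add: matrix_transpose_mul transpose_matrix_inv[OF assms] matrix_mul_assoc)

lemma column_space_invariant_if_commutes:
  fixes Z :: "real^'k^'m" and T :: "real^'m^'m"
  assumes "invertible (transpose Z ** Z)"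
    and "T ** column_projector Z = column_projector Z ** T"
  shows "\<exists>M. T ** Z = Z ** M"
proof -
  have "T ** Z = column_projector Z ** (T ** Z)"
    by (metis assms column_projector_mult matrix_mul_assoc)
  then have "T ** Z = Z ** (matrix_inv (transpose Z ** Z) ** transpose Z ** T ** Z)"
    by (simp add: column_projector_def matrix_mul_assoc)
  then show ?thesis ..
qed

lemma stack_matrix_eq_iff:
  "stack_matrix A B = stack_matrix C D \<longleftrightarrow> A = C \<and> B = D"
proof
  assume *: "stack_matrix A B = stack_matrix C D"
  have "A $ i = C $ i" "B $ j = D $ j" for i j
    using arg_cong[OF *, of "\<lambda>S. S $ Inl i"] arg_cong[OF *, of "\<lambda>S. S $ Inr j"]
    by (simp_all add: stack_matrix_def)
  then show "A = C \<and> B = D"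
    by (simp add: vec_eq_iff)
qed simp

lemma stack_matrix_mult: "stack_matrix A B ** M = stack_matrix (A ** M) (B ** M)"
  by (simp add: stack_matrix_def matrix_matrix_mult_def vec_eq_iff split: sum.split)

lemma sum_UNIV_sum_type:
  fixes f :: "'a::finite + 'b::finite \<Rightarrow> real"
  shows "(\<Sum>x\<in>UNIV. f x) = (\<Sum>a\<in>UNIV. f (Inl a)) + (\<Sum>b\<in>UNIV. f (Inr b))"
  by (simp add: sum.Plus flip: UNIV_Plus_UNIV)

lemma block_matrix_mult_stack_matrix:
  "block_matrix A B C D ** stack_matrix X Y = stack_matrix (A ** X + B ** Y) (C ** X + D ** Y)"
  by (simp add: block_matrix_def stack_matrix_def matrix_matrix_mult_def vec_eq_iff
      sum_UNIV_sum_type split: sum.split)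

lemma transpose_block_matrix:
  "transpose (block_matrix A B C D) =
    block_matrix (transpose A) (transpose C) (transpose B) (transpose D)"
  by (simp add: block_matrix_def transpose_def vec_eq_iff split: sum.split)

lemma stack_matrix_kernel:
  assumes "\<And>v. X *v v = 0 \<Longrightarrow> v = 0" and "stack_matrix X K *v v = 0"
  shows "v = 0"
proof -
  have "(X *v v) $ i = (stack_matrix X K *v v) $ Inl i" for i
    by (simp add: stack_matrix_def matrix_vector_mult_def)
  with assms show ?thesis
    by (simp add: vec_eq_iff)
qed

section \<open>Transformations that preserve the stacked design\<close>

text \<open>
  The block diagonal matrix with blocks \<open>A\<close> and \<open>I\<close> maps the column space of the stacked matrix
  \<open>(X; K)\<close> onto itself, \<open>G\<close> being the induced change of coordinates.
\<close>
definition stack_invariant :: "real^'k^'n \<Rightarrow> real^'k^'k \<Rightarrow> real^'n^'n \<Rightarrow> bool" where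
  "stack_invariant X K A \<longleftrightarrow> (\<exists>G. invertible G \<and> A ** X = X ** G \<and> K ** G = K)"

lemma stack_invariant_mult:
  assumes "stack_invariant X K A" "stack_invariant X K B"
  shows "stack_invariant X K (A ** B)"
proof -
  obtain G H where "invertible G" "A ** X = X ** G" "K ** G = K"
    and "invertible H" "B ** X = X ** H" "K ** H = K"
    using assms unfolding stack_invariant_def by blast
  then have "invertible (G ** H) \<and> A ** B ** X = X ** (G ** H) \<and> K ** (G ** H) = K"
    by (metis invertible_mult matrix_mul_assoc)
  then show ?thesis
    unfolding stack_invariant_def by blast
qed

lemma stack_invariant_matrix_inv:
  assumes "stack_invariant X K A" "invertible A"
  shows "stack_invariant X K (matrix_inv A)"
proof -
  obtain G where G: "invertible G" "A ** X = X ** G" "K ** G = K"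
    using assms unfolding stack_invariant_def by blast
  have "X = X ** G ** matrix_inv G"
    using matrix_inv_right[OF G(1)] by (simp flip: matrix_mul_assoc)
  then have "X = A ** (X ** matrix_inv G)"
    by (metis G(2) matrix_mul_assoc)
  then have "matrix_inv A ** X = X ** matrix_inv G"
    by (metis assms(2) matrix_inv_left matrix_mul_assoc matrix_mul_lid)
  moreover have "K ** matrix_inv G = K"
    by (metis G(1,3) matrix_inv_right matrix_mul_assoc matrix_mul_rid)
  ultimately show ?thesis
    unfolding stack_invariant_def using invertible_matrix_inv[OF G(1)] by blast
qed

text \<open>
  The zero blocks next to \<open>W\<close> are what yields \<open>K M = 0\<close>, hence \<open>K (I + c M) = K\<close>.
\<close>
lemma stack_invariant_identity_plus:
  fixes X :: "real^'k^'n" and K :: "real^'k^'k" and W :: "real^'n^'n" and c :: real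
  assumes X: "\<And>v. X *v v = 0 \<Longrightarrow> v = 0"
    and W: "block_matrix W 0 0 0 ** stack_matrix X K = stack_matrix X K ** M"
    and inv: "invertible (mat 1 + c *\<^sub>R W)"
  shows "stack_invariant X K (mat 1 + c *\<^sub>R W)"
proof -
  let ?A = "mat 1 + c *\<^sub>R W" and ?G = "mat 1 + c *\<^sub>R M"
  from W have "stack_matrix (W ** X) 0 = stack_matrix (X ** M) (K ** M)"
    by (simp add: block_matrix_mult_stack_matrix stack_matrix_mult)
  then have WX: "W ** X = X ** M" and KM: "K ** M = 0"
    by (auto simp: stack_matrix_eq_iff)
  have AX: "?A ** X = X ** ?G"
    by (simp add: matrix_add_rdistrib matrix_add_ldistrib matrix_scalar_ac WX
        flip: scalar_matrix_assoc)
  have "K ** ?G = K"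
    by (simp add: matrix_add_ldistrib matrix_scalar_ac KM flip: scalar_matrix_assoc)
  moreover have "invertible ?G"
  proof (rule invertible_if_trivial_kernel)
    fix v
    assume "?G *v v = 0"
    then have "?A *v (X *v v) = 0"
      by (metis AX matrix_vector_mul_assoc matrix_vector_mult_0_right)
    then have "X *v v = 0"
      by (metis inv matrix_inv_left matrix_vector_mul_assoc matrix_vector_mul_lid
          matrix_vector_mult_0_right)
    then show "v = 0"
      by (rule X)
  qed
  ultimately show ?thesis
    unfolding stack_invariant_def using AX by blast
qed

text \<open>
  The normal equations for \<open>\<Phi>\<close> are those for the identity multiplied from the left by \<open>G\<^sup>T\<close>,
  which is invertible and therefore cancels.
\<close>
lemma ridge_estimator_eq_if_stack_invariant:
  fixes X :: "real^'k^'n" and K :: "real^'k^'k" and \<Phi> :: "real^'n^'n"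
  assumes X: "\<And>v. X *v v = 0 \<Longrightarrow> v = 0" and K: "symmetric_psd K"
    and sym: "transpose (matrix_inv \<Phi>) = matrix_inv \<Phi>"
    and "stack_invariant X K (matrix_inv \<Phi>)"
  shows "ridge_estimator X \<Phi> K y = ridge_estimator X (mat 1) K y"
proof -
  let ?S = "transpose X ** X + K"
  obtain G where G: "invertible G" and XG: "matrix_inv \<Phi> ** X = X ** G" and KG: "K ** G = K"
    using assms(4) unfolding stack_invariant_def by blast
  let ?H = "transpose G"
  have H: "invertible ?H"
    by (rule transpose_invertible[OF G])
  have S: "invertible ?S"
    using X K by (intro invertible_gram_plus_psd) (auto simp: symmetric_psd_def)
  have HX: "transpose X ** matrix_inv \<Phi> = ?H ** transpose X"
    using arg_cong[OF XG, of transpose] by (simp add: matrix_transpose_mul sym)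
  have HK: "?H ** K = K"
    using arg_cong[OF KG, of transpose] K by (simp add: matrix_transpose_mul symmetric_psd_def)
  have "transpose X ** matrix_inv \<Phi> ** X + K = ?H ** ?S"
    by (simp add: HX HK matrix_add_ldistrib matrix_mul_assoc)
  then have "ridge_estimator X \<Phi> K y =
      (matrix_inv (?H ** ?S) ** (transpose X ** matrix_inv \<Phi>)) *v y"
    unfolding ridge_estimator_def by (simp only: matrix_vector_mul_assoc matrix_mul_assoc)
  also have "matrix_inv (?H ** ?S) ** (transpose X ** matrix_inv \<Phi>) =
      matrix_inv ?S ** (matrix_inv ?H ** ?H) ** transpose X"
    by (simp add: HX matrix_inv_product[OF H S] matrix_mul_assoc)
  also have "\<dots> = matrix_inv ?S ** transpose X"
    by (simp add: matrix_inv_left[OF H])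
  also have "\<dots> *v y = ridge_estimator X (mat 1) K y"
    unfolding ridge_estimator_def
    by (simp only: matrix_inv_mat_1 matrix_mul_rid matrix_vector_mul_lid matrix_vector_mul_assoc)
  finally show ?thesis .
qed

section \<open>Spatial disturbance processes\<close>

theorem theorem3p5:
  fixes X :: "real^'k^'n"
    and K :: "real^'k^'k"
    and W \<Omega> :: "real^'n^'n"
    and \<rho> :: real
    and W' :: "real^('n + 'k)^('n + 'k)"
    and Z :: "real^'k^('n + 'k)"
  assumes "CARD('k) < CARD('n)"
    and "rank X = CARD('k)"
    and "symmetric_psd K"
    and "spatial_weights_matrix W"
    and "\<rho> \<noteq> 0"
    and "(invertible (mat 1 - \<rho> *\<^sub>R W) \<and>
           \<Omega> = matrix_inv (mat 1 - \<rho> *\<^sub>R W) ** matrix_inv (mat 1 - \<rho> *\<^sub>R transpose W)) \<or>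
         (invertible (mat 1 + \<rho> *\<^sub>R W) \<and>
           \<Omega> = (mat 1 + \<rho> *\<^sub>R W) ** (mat 1 + \<rho> *\<^sub>R transpose W))"
    and "W' = block_matrix W 0 0 0"
    and "Z = stack_matrix X K"
    and "W' ** column_projector Z = column_projector Z ** W'"
  shows "\<forall>y :: real^'n. ridge_estimator X \<Omega> K y = ridge_estimator X (mat 1) K y"
proof
  fix y :: "real^'n"
  have X: "v = 0" if "X *v v = 0" for v
  proof -
    have "inj ((*v) X)"
      using assms(2) by (simp add: full_rank_injective)
    then show "v = 0"
      using that by (metis injD matrix_vector_mult_0_right)
  qed
  have "v = 0" if "Z *v v = 0" for v
    using X that unfolding assms(8) by (rule stack_matrix_kernel)
  then have gram: "invertible (transpose Z ** Z)"
    using invertible_gram_plus_psd[of Z 0] by simp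
  obtain M where M: "block_matrix W 0 0 0 ** stack_matrix X K = stack_matrix X K ** M"
    using column_space_invariant_if_commutes[OF gram assms(9)] assms(7,8) by blast
  have "transpose W' ** column_projector Z = column_projector Z ** transpose W'"
    using arg_cong[OF assms(9), of transpose]
    by (simp add: matrix_transpose_mul transpose_column_projector[OF gram])
  moreover have "transpose W' = block_matrix (transpose W) 0 0 0"
    using assms(7) by (simp add: transpose_block_matrix transpose_zero)
  ultimately obtain N
    where N: "block_matrix (transpose W) 0 0 0 ** stack_matrix X K = stack_matrix X K ** N"
    using column_space_invariant_if_commutes[OF gram] assms(8) by metis

  (* The moving average form has c = \<rho>, the autoregressive form c = -\<rho>; \<Omega> is A A\<^sup>T in the
     former and the inverse of A\<^sup>T A in the latter. *)
  define A where "A c = mat 1 + c *\<^sub>R W" for c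
  have At: "transpose (A c) = mat 1 + c *\<^sub>R transpose W" for c
    by (simp add: A_def transpose_add transpose_scalar)
  have A_inv: "stack_invariant X K (A c)" if "invertible (A c)" for c
    using stack_invariant_identity_plus[OF X M] that by (simp add: A_def)
  have At_inv: "stack_invariant X K (transpose (A c))" if "invertible (A c)" for c
    using stack_invariant_identity_plus[OF X N] transpose_invertible[OF that]
    by (simp add: At)
  from assms(6) consider
      (AR) "invertible (A (-\<rho>))" "\<Omega> = matrix_inv (A (-\<rho>)) ** matrix_inv (transpose (A (-\<rho>)))"
    | (MA) "invertible (A \<rho>)" "\<Omega> = A \<rho> ** transpose (A \<rho>)"
    by (auto simp: At) (auto simp: A_def)
  then have "transpose (matrix_inv \<Omega>) = matrix_inv \<Omega> \<and> stack_invariant X K (matrix_inv \<Omega>)"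
  proof cases
    case AR
    let ?B = "A (-\<rho>)"
    have Bt: "invertible (transpose ?B)"
      by (rule transpose_invertible[OF AR(1)])
    have "matrix_inv \<Omega> = transpose ?B ** ?B"
      using AR Bt by (simp add: matrix_inv_product invertible_matrix_inv matrix_inv_matrix_inv)
    then show ?thesis
      using stack_invariant_mult[OF At_inv[OF AR(1)] A_inv[OF AR(1)]]
      by (simp add: matrix_transpose_mul)
  next
    case MA
    have inv: "invertible \<Omega>"
      using MA transpose_invertible[OF MA(1)] by (simp add: invertible_mult)
    have "transpose \<Omega> = \<Omega>"
      using MA(2) by (simp add: matrix_transpose_mul)
    then have "transpose (matrix_inv \<Omega>) = matrix_inv \<Omega>"
      by (simp add: transpose_matrix_inv[OF inv])
    moreover have "stack_invariant X K \<Omega>"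
      using stack_invariant_mult[OF A_inv[OF MA(1)] At_inv[OF MA(1)]] MA(2) by simp
    ultimately show ?thesis
      using stack_invariant_matrix_inv inv by blast
  qed
  then show "ridge_estimator X \<Omega> K y = ridge_estimator X (mat 1) K y"
    using ridge_estimator_eq_if_stack_invariant[OF X assms(3)] by blast
qed

end
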